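(* For any $0<\epsilon,\delta<1$, the DP Gradient EM Algorithm described in the context, run with privacy parameters $\epsilon,\delta$ (and any admissible remaining inputs), is $(\epsilon,\delta)$-differentially private.
   Context: Differential privacy: datasets $D,D'$ (of $n$ records) are neighbors, $D\sim D'$, if they differ in one entry. A randomized algorithm $\mathcal{A}$ is $(\epsilon,\delta)$-differentially private (DP) if for all $D\sim D'$ and all events $S$ in the output space, $\mathbb{P}(\mathcal{A}(D)\in S)\le e^\epsilon\,\mathbb{P}(\mathcal{A}(D')\in S)+\delta$. Truncation function: $\phi(u)=u-\frac{u^3}{6}$ for $|u|\le\sqrt2$, $\phi(u)=\frac{2\sqrt2}{3}$ for $u>\sqrt2$, $\phi(u)=-\frac{2\sqrt2}{3}$ for $u<-\sqrt2$. DP Gradient EM Algorithm. Inputs: data $D=(y_1,\dots,y_n)$; a per-sample gradient map $\nabla q_i(\beta;\beta)\in\mathbb{R}^d$, which depends only on the record $y_i$ and on $\beta\in\mathbb{R}^d$ (in the EM setting it is the gradient, in the first argument, of $q_i(\beta;\beta')=\int k_{\beta'}(z|y_i)\log f_\beta(y_i,z)\,dz$, where $f_\beta(y,z)$ is a parametric joint density and $k_\beta(z|y)$ the conditional density of the latent variable); initial parameter $\beta^0$; $\tau>0$; number of iterations $T$; step size $\eta>0$; failure probability $\zeta\in(0,1)$; privacy parameters $\epsilon,\delta$. Set $\tilde\epsilon=\sqrt{\log\frac1\delta+\epsilon}-\sqrt{\log\frac1\delta}$, $m=n/T$, $s=\frac{\sqrt{m\tau\tilde\epsilon}}{2\log\frac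 d\zeta}$, $\lambda=\sqrt{\log\frac d\zeta}$. Partition $D$ into $T$ disjoint subsets $D_1,\dots,D_T$ with $|D_t|=m$ (the partition of indices being independent of the data values). For $t=1,\dots,T$: for each $j\in[d]$ compute $$g_j^{t-1}=\frac sm\sum_{i:\,y_i\in D_t}\mathbb{E}_{\xi\sim\mathcal{N}(0,1/\lambda)}\,\phi\left(\frac{(1+\xi)\nabla_jq_i(\beta^{t-1};\beta^{t-1})}{s}\right)+Z_j^{t-1},\qquad Z_j^{t-1}\sim\mathcal{N}\left(0,\frac{16s^2d}{9m^2\tilde\epsilon^2}\right),$$ with all $Z_j^{t-1}$ independent, and update $\beta^t=\beta^{t-1}+\eta\,(g_1^{t-1},\dots,g_d^{t-1})$. The output is $\beta^T$. *)

theory Defs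
  imports "HOL-Probability.Probability"
begin

definition neighbors :: "'r list \<Rightarrow> 'r list \<Rightarrow> bool" where
  "neighbors D D' \<longleftrightarrow>
     length D = length D' \<and> card {i. i < length D \<and> D ! i \<noteq> D' ! i} = 1"

text \<open>A randomized algorithm on datasets of \<open>n\<close> records is represented by the map sending a
  dataset to the law of the output, a probability measure on the output space \<open>M\<close>. That it
  really takes values in probability measures is part of the definition.\<close>

definition differentially_private ::
    "real \<Rightarrow> real \<Rightarrow> nat \<Rightarrow> 'o measure \<Rightarrow> ('r list \<Rightarrow> 'o measure) \<Rightarrow> bool" where
  "differentially_private \<epsilon> \<delta> n M A \<longleftrightarrow>
     (\<forall>D. length D = n \<longrightarrow> prob_space (A D) \<and> sets (A D) = sets M) \<and>
     (\<forall>D D'. length D = n \<longrightarrow> length D' = n \<longrightarrow> neighbors D D' \<longrightarrow>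
        (\<forall>S\<in>sets M. measure (A D) S \<le> exp \<epsilon> * measure (A D') S + \<delta>))"

definition trunc_phi :: "real \<Rightarrow> real" where
  "trunc_phi u =
     (if \<bar>u\<bar> \<le> sqrt 2 then u - u ^ 3 / 6
      else if u > sqrt 2 then 2 * sqrt 2 / 3
      else - (2 * sqrt 2 / 3))"

text \<open>The argument is the variance, whereas \<^const>\<open>normal_density\<close> expects the standard
  deviation.\<close>

definition centered_gaussian :: "real \<Rightarrow> real measure" where
  "centered_gaussian v = density lborel (\<lambda>x. ennreal (normal_density 0 (sqrt v) x))"

definition eps_tilde :: "real \<Rightarrow> real \<Rightarrow> real" where
  "eps_tilde \<epsilon> \<delta> = sqrt (ln (1 / \<delta>) + \<epsilon>) - sqrt (ln (1 / \<delta>))"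

definition trunc_scale :: "nat \<Rightarrow> real \<Rightarrow> real \<Rightarrow> real \<Rightarrow> real \<Rightarrow> real" where
  "trunc_scale d m \<tau> \<zeta> et = sqrt (m * \<tau> * et) / (2 * ln (real d / \<zeta>))"

definition smoothing_precision :: "nat \<Rightarrow> real \<Rightarrow> real" where
  "smoothing_precision d \<zeta> = sqrt (ln (real d / \<zeta>))"

definition noise_variance :: "nat \<Rightarrow> real \<Rightarrow> real \<Rightarrow> real \<Rightarrow> real" where
  "noise_variance d m s et = 16 * s\<^sup>2 * real d / (9 * m\<^sup>2 * et\<^sup>2)"

text \<open>Batches are sets of record positions, numbered \<open>0, \<dots>, T - 1\<close>.\<close>

definition equipartition :: "nat \<Rightarrow> nat \<Rightarrow> (nat \<Rightarrow> nat set) \<Rightarrow> bool" where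
  "equipartition n T B \<longleftrightarrow>
     disjoint_family_on B {..<T} \<and> (\<Union>t<T. B t) = {..<n} \<and>
     (\<forall>t<T. real (card (B t)) = real n / real T)"

text \<open>Here \<open>grad y \<beta>\<close> stands for the per-sample gradient at record \<open>y\<close>, i.e. the gradient of
  \<open>q(\<cdot>; \<beta>)\<close> evaluated at \<open>\<beta>\<close>.\<close>

definition robust_gradient ::
    "('r \<Rightarrow> real ^ 'd \<Rightarrow> real ^ 'd) \<Rightarrow> real \<Rightarrow> real \<Rightarrow> real \<Rightarrow> nat set \<Rightarrow> 'r list
      \<Rightarrow> real ^ 'd \<Rightarrow> real ^ 'd" where
  "robust_gradient grad m s lam I D \<beta> =
     (\<chi> j. s / m * (\<Sum>i\<in>I. \<integral>\<xi>. trunc_phi ((1 + \<xi>) * (grad (D ! i) \<beta> $ j) / s)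
                            \<partial>centered_gaussian (1 / lam)))"

text \<open>The iterates as a function of a realization \<open>z\<close> of all the noise variables.\<close>

primrec em_iterate ::
    "('r \<Rightarrow> real ^ 'd \<Rightarrow> real ^ 'd) \<Rightarrow> real ^ 'd \<Rightarrow> real \<Rightarrow> real \<Rightarrow> real \<Rightarrow> real
      \<Rightarrow> (nat \<Rightarrow> nat set) \<Rightarrow> 'r list \<Rightarrow> (nat \<times> 'd \<Rightarrow> real) \<Rightarrow> nat \<Rightarrow> real ^ 'd" where
  "em_iterate grad \<beta>0 \<eta> m s lam B D z 0 = \<beta>0"
| "em_iterate grad \<beta>0 \<eta> m s lam B D z (Suc t) =
     (let \<beta> = em_iterate grad \<beta>0 \<eta> m s lam B D z t
      in \<beta> + \<eta> *\<^sub>R (robust_gradient grad m s lam (B t) D \<beta> + (\<chi> j. z (t, j))))"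

text \<open>The law of the last iterate. The partition of the record positions is drawn from \<open>P\<close>,
  which does not depend on the data; a deterministic partition is a point mass. The noise
  variables are independent of each other (product measure) and of the partition.\<close>

definition dp_gradient_em ::
    "('r \<Rightarrow> real ^ 'd \<Rightarrow> real ^ 'd) \<Rightarrow> real ^ 'd \<Rightarrow> real \<Rightarrow> nat \<Rightarrow> real \<Rightarrow> real
      \<Rightarrow> real \<Rightarrow> real \<Rightarrow> (nat \<Rightarrow> nat set) pmf \<Rightarrow> 'r list \<Rightarrow> (real ^ 'd) measure" where
  "dp_gradient_em grad \<beta>0 \<tau> T \<eta> \<zeta> \<epsilon> \<delta> P D =
     (let d = CARD('d);
          m = real (length D) / real T;
          et = eps_tilde \<epsilon> \<delta>;
          s = trunc_scale d m \<tau> \<zeta> et;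
          lam = smoothing_precision d \<zeta>;
          noise = Pi\<^sub>M ({..<T} \<times> UNIV) (\<lambda>_. centered_gaussian (noise_variance d m s et))
      in measure_pmf P \<bind>
           (\<lambda>B. distr noise borel (\<lambda>z. em_iterate grad \<beta>0 \<eta> m s lam B D z T)))"

end

theory Submission
  imports Defs
begin

text \<open>Two neighboring datasets differ in a single batch \<open>t0\<close>. The runs on them agree before step \<open>t0\<close>,
  and afterwards they coincide as soon as the iterates after step \<open>t0\<close> do. So passing from one dataset
  to the other amounts to shifting the Gaussian noise of step \<open>t0\<close> by the difference of the two robust
  gradients at the current iterate. Since the truncation is bounded by \<open>2 * sqrt 2 / 3\<close>, this shift
  has squared length at most \<open>32 * s\<^sup>2 * d / (9 * m\<^sup>2) = 2 * k\<^sup>2 * \<sigma>\<^sup>2\<close>, where \<open>k = eps_tilde \<epsilon> \<delta>\<close> and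
  \<open>\<sigma>\<^sup>2\<close> is the noise variance. Hence one step is zero-concentrated differentially private with
  parameter \<open>k\<^sup>2\<close>, which gives \<open>(\<epsilon>, \<delta>)\<close>-privacy for \<open>\<epsilon> = k\<^sup>2 + 2 * k * sqrt (ln (1 / \<delta>))\<close>; the definition
  of \<open>eps_tilde\<close> solves this equation for \<open>k\<close>.\<close>

section \<open>Product Gaussians: joint density and translation\<close>

text \<open>\<open>\<sigma>\<close> is the standard deviation, whereas
  \<open>centered_gaussian\<close> takes the variance. The mean vector \<open>w\<close> is kept as a
  parameter so that shifting the noise becomes a change of mean.\<close>

definition gaussian_vec :: "'i set \<Rightarrow> real \<Rightarrow> ('i \<Rightarrow> real) \<Rightarrow> ('i \<Rightarrow> real) measure" where
  "gaussian_vec J \<sigma> w = Pi\<^sub>M J (\<lambda>j. density lborel (\<lambda>x. ennreal (normal_density (w j) \<sigma> x)))"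

lemma sets_gaussian_vec [measurable_cong]: "sets (gaussian_vec J \<sigma> w) = sets (Pi\<^sub>M J (\<lambda>_. borel))"
  unfolding gaussian_vec_def by (intro sets_PiM_cong) auto

lemma prob_space_gaussian_vec: "0 < \<sigma> \<Longrightarrow> prob_space (gaussian_vec J \<sigma> w)"
  unfolding gaussian_vec_def by (intro prob_space_PiM prob_space_normal_density)

text \<open>A product measure is determined by its values on boxes, and there the integral of the
  product density factorizes. The joint density is what allows a pointwise inequality between
  densities to be integrated.\<close>

lemma gaussian_vec_eq_density:
  fixes w :: "'i \<Rightarrow> real"
  assumes "finite J" and "0 < \<sigma>"
  shows "gaussian_vec J \<sigma> w =
    density (Pi\<^sub>M J (\<lambda>_. lborel)) (\<lambda>z. ennreal (\<Prod>j\<in>J. normal_density (w j) \<sigma> (z j)))"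
    (is "_ = density ?L ?f")
proof -
  let ?N = "\<lambda>j. density lborel (\<lambda>x. ennreal (normal_density (w j) \<sigma> x))"
  interpret N: product_sigma_finite ?N
    using prob_space_normal_density[OF \<open>0 < \<sigma>\<close>]
    by (intro product_sigma_finite.intro prob_space_imp_sigma_finite)
  interpret L: product_sigma_finite "\<lambda>_::'i. lborel :: real measure"
    by standard
  have "density ?L ?f = Pi\<^sub>M J ?N"
  proof (rule N.PiM_eqI[OF \<open>finite J\<close>])
    have "sets ?L = sets (Pi\<^sub>M J ?N)"
      by (intro sets_PiM_cong) auto
    then show "sets (density ?L ?f) = sets (Pi\<^sub>M J ?N)" by simp
    fix A assume "\<And>j. j \<in> J \<Longrightarrow> A j \<in> sets (?N j)"
    then have A: "\<And>j. j \<in> J \<Longrightarrow> A j \<in> sets lborel" by simp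
    have box: "Pi\<^sub>E J A \<in> sets ?L"
      using A \<open>finite J\<close> by (intro sets_PiM_I_finite) auto
    have "emeasure (density ?L ?f) (Pi\<^sub>E J A)
        = (\<integral>\<^sup>+z. ?f z * indicator (Pi\<^sub>E J A) z \<partial>?L)"
      using box by (intro emeasure_density) auto
    also have "\<dots> = (\<integral>\<^sup>+z. (\<Prod>j\<in>J. ennreal (normal_density (w j) \<sigma> (z j)) * indicator (A j) (z j)) \<partial>?L)"
    proof (rule nn_integral_cong)
      fix z assume "z \<in> space ?L"
      \<comment> \<open>Extensionality reduces membership in the box to conditions on the
        coordinates in \<open>J\<close>, so its indicator is a product.\<close>
      then have "z \<in> extensional J" by (auto simp: space_PiM PiE_def)
      then have "indicator (Pi\<^sub>E J A) z = (\<Prod>j\<in>J. indicator (A j) (z j) :: ennreal)"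
        using \<open>finite J\<close> by (auto simp: indicator_def PiE_def Pi_def prod_eq_1_iff)
      then show "?f z * indicator (Pi\<^sub>E J A) z =
          (\<Prod>j\<in>J. ennreal (normal_density (w j) \<sigma> (z j)) * indicator (A j) (z j))"
        by (simp add: prod.distrib prod_ennreal)
    qed
    also have "\<dots> = (\<Prod>j\<in>J. \<integral>\<^sup>+x. ennreal (normal_density (w j) \<sigma> x) * indicator (A j) x \<partial>lborel)"
      using A \<open>finite J\<close> by (intro L.product_nn_integral_prod) auto
    also have "\<dots> = (\<Prod>j\<in>J. emeasure (?N j) (A j))"
      using A by (intro prod.cong) (auto simp: emeasure_density)
    finally show "emeasure (density ?L ?f) (Pi\<^sub>E J A) = (\<Prod>j\<in>J. emeasure (?N j) (A j))" .
  qed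
  then show ?thesis by (simp add: gaussian_vec_def)
qed

text \<open>Boxes suffice again: the preimage of a box under a translation is a box, and in each
  coordinate the substitution \<open>x = w j + y\<close> moves the mean from \<open>0\<close> to
  \<open>w j\<close>.\<close>

lemma gaussian_vec_shift:
  fixes w :: "'i \<Rightarrow> real"
  assumes "finite J" and "0 < \<sigma>"
  shows "distr (gaussian_vec J \<sigma> (\<lambda>_. 0)) (Pi\<^sub>M J (\<lambda>_. borel)) (\<lambda>z. \<lambda>j\<in>J. z j + w j) =
    gaussian_vec J \<sigma> w" (is "distr ?G ?B ?h = _")
proof -
  let ?N = "\<lambda>u. density lborel (\<lambda>x. ennreal (normal_density u \<sigma> x))"
  interpret N: product_sigma_finite "\<lambda>j. ?N (w j)"
    using prob_space_normal_density[OF \<open>0 < \<sigma>\<close>]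
    by (intro product_sigma_finite.intro prob_space_imp_sigma_finite)
  interpret Z: product_sigma_finite "\<lambda>_::'i. ?N 0"
    using prob_space_normal_density[OF \<open>0 < \<sigma>\<close>]
    by (intro product_sigma_finite.intro prob_space_imp_sigma_finite)
  have h: "?h \<in> measurable ?G ?B" by measurable
  have "distr ?G ?B ?h = Pi\<^sub>M J (\<lambda>j. ?N (w j))"
  proof (rule N.PiM_eqI[OF \<open>finite J\<close>])
    show "sets (distr ?G ?B ?h) = sets (Pi\<^sub>M J (\<lambda>j. ?N (w j)))"
      unfolding sets_distr by (intro sets_PiM_cong) auto
    fix A assume "\<And>j. j \<in> J \<Longrightarrow> A j \<in> sets (?N (w j))"
    then have A: "\<And>j. j \<in> J \<Longrightarrow> A j \<in> sets borel" by simp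
    have A': "(\<lambda>x. x + w j) -` A j \<in> sets borel" if "j \<in> J" for j
      using measurable_sets_borel[of "\<lambda>x. x + w j" borel "A j"] A[OF that] by simp
    have shift: "emeasure (?N 0) ((\<lambda>x. x + w j) -` A j) = emeasure (?N (w j)) (A j)"
      if "j \<in> J" for j
    proof -
      have [measurable]: "A j \<in> sets borel" using A that .
      have "emeasure (?N (w j)) (A j)
          = (\<integral>\<^sup>+x. ennreal (normal_density (w j) \<sigma> x) * indicator (A j) x \<partial>lborel)"
        by (simp add: emeasure_density)
      also have "\<dots> = (\<integral>\<^sup>+x. ennreal (normal_density (w j) \<sigma> (w j + 1 * x)) * indicator (A j) (w j + 1 * x) \<partial>lborel)"
        by (subst nn_integral_real_affine[where c = 1 and t = "w j"]) auto
      also have "\<dots> = (\<integral>\<^sup>+x. ennreal (normal_density 0 \<sigma> x) * indicator ((\<lambda>x. x + w j) -` A j) x \<partial>lborel)"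
        by (intro nn_integral_cong) (auto simp: normal_density_def indicator_def add.commute)
      also have "\<dots> = emeasure (?N 0) ((\<lambda>x. x + w j) -` A j)"
        using A'[OF that] by (simp add: emeasure_density)
      finally show ?thesis by simp
    qed
    have box: "Pi\<^sub>E J A \<in> sets ?B"
      using A \<open>finite J\<close> by (intro sets_PiM_I_finite) auto
    have pre: "?h -` Pi\<^sub>E J A \<inter> space ?G = (\<Pi>\<^sub>E j\<in>J. (\<lambda>x. x + w j) -` A j)"
      by (auto simp: gaussian_vec_def space_PiM PiE_def Pi_def)
    have "emeasure (distr ?G ?B ?h) (Pi\<^sub>E J A) = emeasure ?G (\<Pi>\<^sub>E j\<in>J. (\<lambda>x. x + w j) -` A j)"
      by (simp add: emeasure_distr[OF h box] pre)
    also have "\<dots> = (\<Prod>j\<in>J. emeasure (?N 0) ((\<lambda>x. x + w j) -` A j))"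
      unfolding gaussian_vec_def using A' \<open>finite J\<close> by (intro Z.emeasure_PiM) auto
    also have "\<dots> = (\<Prod>j\<in>J. emeasure (?N (w j)) (A j))"
      by (intro prod.cong refl shift)
    finally show "emeasure (distr ?G ?B ?h) (Pi\<^sub>E J A) = (\<Prod>j\<in>J. emeasure (?N (w j)) (A j))" .
  qed
  then show ?thesis by (simp add: gaussian_vec_def)
qed

section \<open>Privacy of Gaussian noise under bounded shifts\<close>

lemma normal_density_shift:
  assumes "0 < \<sigma>"
  shows "normal_density u \<sigma> x = normal_density 0 \<sigma> x * exp (x * u / \<sigma>\<^sup>2 - u\<^sup>2 / (2 * \<sigma>\<^sup>2))"
proof -
  have "- (x - u)\<^sup>2 / (2 * \<sigma>\<^sup>2) = - (x - 0)\<^sup>2 / (2 * \<sigma>\<^sup>2) + (x * u / \<sigma>\<^sup>2 - u\<^sup>2 / (2 * \<sigma>\<^sup>2))"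
    using assms by (simp add: field_simps power2_eq_square)
  then show ?thesis
    unfolding normal_density_def by (simp only: exp_add mult.assoc)
qed

text \<open>The multiplier \<open>c\<close> is kept apart because the Chernoff bound compares
  \<open>c = 1\<close> with \<open>c = 1 + l\<close> along the same vector: the exponent is a
  quadratic polynomial in \<open>c\<close> whose coefficients do not depend on
  \<open>c\<close>.\<close>

lemma prod_normal_density_shift:
  assumes "0 < \<sigma>" and "finite J"
  shows "(\<Prod>j\<in>J. normal_density (c * w j) \<sigma> (z j)) = (\<Prod>j\<in>J. normal_density 0 \<sigma> (z j)) *
    exp (c * (\<Sum>j\<in>J. z j * w j / \<sigma>\<^sup>2) - c\<^sup>2 * ((\<Sum>j\<in>J. (w j)\<^sup>2) / (2 * \<sigma>\<^sup>2)))"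
proof -
  have "(\<Prod>j\<in>J. normal_density (c * w j) \<sigma> (z j)) = (\<Prod>j\<in>J. normal_density 0 \<sigma> (z j)) *
      exp (\<Sum>j\<in>J. z j * (c * w j) / \<sigma>\<^sup>2 - (c * w j)\<^sup>2 / (2 * \<sigma>\<^sup>2))"
    by (simp add: normal_density_shift[OF assms(1), of "c * w _"] prod.distrib exp_sum[OF assms(2)])
  also have "(\<Sum>j\<in>J. z j * (c * w j) / \<sigma>\<^sup>2 - (c * w j)\<^sup>2 / (2 * \<sigma>\<^sup>2)) =
      c * (\<Sum>j\<in>J. z j * w j / \<sigma>\<^sup>2) - c\<^sup>2 * ((\<Sum>j\<in>J. (w j)\<^sup>2) / (2 * \<sigma>\<^sup>2))"
    by (simp add: sum_subtractf sum_distrib_left sum_divide_distrib power_mult_distrib mult_ac)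
  finally show ?thesis .
qed

text \<open>The Chernoff bound on the privacy loss, applied before integration: the exceptional part of
  the shifted density is dominated by the density shifted by \<open>1 + l\<close> times the vector, where
  \<open>l = sqrt (ln (1 / \<delta>)) / k\<close> is the optimal exponent for \<open>\<rho> = k\<^sup>2\<close>.\<close>

lemma gaussian_density_privacy:
  assumes "0 < \<sigma>" and "finite J" and "0 < k" and "0 < \<delta>" and "\<delta> < 1"
    and eps: "\<epsilon> = k\<^sup>2 + 2 * k * sqrt (ln (1 / \<delta>))"
    and w: "(\<Sum>j\<in>J. (w j)\<^sup>2) \<le> 2 * k\<^sup>2 * \<sigma>\<^sup>2"
  defines "l \<equiv> sqrt (ln (1 / \<delta>)) / k"
  shows "(\<Prod>j\<in>J. normal_density (w j) \<sigma> (z j)) \<le>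
    exp \<epsilon> * (\<Prod>j\<in>J. normal_density 0 \<sigma> (z j)) +
    \<delta> * (\<Prod>j\<in>J. normal_density ((1 + l) * w j) \<sigma> (z j))"
proof -
  define a where "a = (\<Sum>j\<in>J. z j * w j / \<sigma>\<^sup>2)"
  define b where "b = (\<Sum>j\<in>J. (w j)\<^sup>2) / (2 * \<sigma>\<^sup>2)"
  define r where "r = sqrt (ln (1 / \<delta>))"
  have "0 \<le> ln (1 / \<delta>)" using assms(4,5) by simp
  then have "0 \<le> r" and r2: "r\<^sup>2 = ln (1 / \<delta>)" by (simp_all add: r_def)
  have l: "0 \<le> l" "l * k = r" using \<open>0 < k\<close> \<open>0 \<le> r\<close> by (simp_all add: l_def r_def)
  have "b \<le> k\<^sup>2" using w \<open>0 < \<sigma>\<close> by (simp add: b_def field_simps)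
  have "\<delta> = exp (- r\<^sup>2)" using assms(4) by (simp add: r2 ln_div)
  \<comment> \<open>The centered density is a common factor. Without it, \<open>exp (a - b)\<close>
    is the likelihood ratio for the shift \<open>w\<close>, and the exponential next to
    \<open>\<delta>\<close> is the ratio for the shift \<open>(1 + l) * w\<close>.\<close>
  have "exp (a - b) \<le> exp \<epsilon> + \<delta> * exp ((1 + l) * a - (1 + l)\<^sup>2 * b)"
  proof (cases "a - b \<le> \<epsilon>")
    case True
    then show ?thesis using assms(4) by (intro add_increasing2) auto
  next
    case False
    \<comment> \<open>With \<open>\<delta> = exp (- r\<^sup>2)\<close>, the goal in this case is
      \<open>r\<^sup>2 \<le> l * (a - b) - (l + l\<^sup>2) * b\<close>. The extreme values
      \<open>a - b = \<epsilon>\<close> and \<open>b = k\<^sup>2\<close> give equality.\<close>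
    have "l * \<epsilon> = l * k\<^sup>2 + 2 * r\<^sup>2"
      unfolding eps r_def[symmetric] using l(2) by (simp add: distrib_left power2_eq_square mult_ac)
    moreover have "l\<^sup>2 * k\<^sup>2 = r\<^sup>2" using l(2) by (metis power_mult_distrib)
    ultimately have "l * \<epsilon> = (l + l\<^sup>2) * k\<^sup>2 + r\<^sup>2" by (simp add: algebra_simps)
    moreover have "(l + l\<^sup>2) * b \<le> (l + l\<^sup>2) * k\<^sup>2"
      using \<open>b \<le> k\<^sup>2\<close> l(1) by (intro mult_left_mono) auto
    moreover have "l * \<epsilon> \<le> l * (a - b)"
      using False l(1) by (intro mult_left_mono) auto
    ultimately have "a - b \<le> - r\<^sup>2 + ((1 + l) * a - (1 + l)\<^sup>2 * b)"
      by (simp add: algebra_simps power2_eq_square)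
    then have "exp (a - b) \<le> \<delta> * exp ((1 + l) * a - (1 + l)\<^sup>2 * b)"
      unfolding \<open>\<delta> = _\<close> exp_add[symmetric] by simp
    then show ?thesis by (simp add: add_increasing)
  qed
  moreover have "0 \<le> (\<Prod>j\<in>J. normal_density 0 \<sigma> (z j))" by (simp add: prod_nonneg)
  ultimately have "(\<Prod>j\<in>J. normal_density 0 \<sigma> (z j)) * exp (a - b) \<le>
      (\<Prod>j\<in>J. normal_density 0 \<sigma> (z j)) * (exp \<epsilon> + \<delta> * exp ((1 + l) * a - (1 + l)\<^sup>2 * b))"
    by (rule mult_left_mono)
  then show ?thesis
    using prod_normal_density_shift[OF assms(1,2), of 1 w z]
      prod_normal_density_shift[OF assms(1,2), of "1 + l" w z]
    by (simp add: a_def b_def algebra_simps)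
qed

text \<open>The pointwise bound is integrated over \<open>S\<close>. Its exceptional term is
  \<open>\<delta>\<close> times the density of a probability measure, so it contributes at most
  \<open>\<delta>\<close>.\<close>

lemma gaussian_vec_privacy:
  fixes w :: "'i \<Rightarrow> real"
  assumes "0 < \<sigma>" and "finite J" and "0 < k" and "0 < \<delta>" and "\<delta> < 1"
    and "\<epsilon> = k\<^sup>2 + 2 * k * sqrt (ln (1 / \<delta>))"
    and "(\<Sum>j\<in>J. (w j)\<^sup>2) \<le> 2 * k\<^sup>2 * \<sigma>\<^sup>2"
    and S: "S \<in> sets (Pi\<^sub>M J (\<lambda>_. borel))"
  shows "emeasure (gaussian_vec J \<sigma> w) S \<le>
    ennreal (exp \<epsilon>) * emeasure (gaussian_vec J \<sigma> (\<lambda>_. 0)) S + ennreal \<delta>"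
proof -
  define l where "l = sqrt (ln (1 / \<delta>)) / k"
  let ?L = "Pi\<^sub>M J (\<lambda>_. lborel) :: ('i \<Rightarrow> real) measure"
  let ?f = "\<lambda>u z. \<Prod>j\<in>J. normal_density (u j) \<sigma> (z j)"
  have "sets ?L = sets (Pi\<^sub>M J (\<lambda>_. borel))" by (intro sets_PiM_cong) auto
  with S have [measurable]: "S \<in> sets ?L" by simp
  have em: "emeasure (gaussian_vec J \<sigma> u) S = (\<integral>\<^sup>+z. ennreal (?f u z) * indicator S z \<partial>?L)" for u
    unfolding gaussian_vec_eq_density[OF assms(2,1)] by (intro emeasure_density) auto
  have "emeasure (gaussian_vec J \<sigma> w) S \<le>
      (\<integral>\<^sup>+z. ennreal (exp \<epsilon>) * (ennreal (?f (\<lambda>_. 0) z) * indicator S z)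
        + ennreal \<delta> * (ennreal (?f (\<lambda>j. (1 + l) * w j) z) * indicator S z) \<partial>?L)"
    unfolding em
  proof (rule nn_integral_mono)
    fix z
    have "ennreal (?f w z) \<le>
        ennreal (exp \<epsilon> * ?f (\<lambda>_. 0) z + \<delta> * ?f (\<lambda>j. (1 + l) * w j) z)"
      using gaussian_density_privacy[OF assms(1-7), of z] unfolding l_def by (rule ennreal_leI)
    also have "\<dots> = ennreal (exp \<epsilon>) * ennreal (?f (\<lambda>_. 0) z)
        + ennreal \<delta> * ennreal (?f (\<lambda>j. (1 + l) * w j) z)"
      using assms(4) by (simp add: ennreal_mult ennreal_plus prod_nonneg)
    finally show "ennreal (?f w z) * indicator S z \<le>
        ennreal (exp \<epsilon>) * (ennreal (?f (\<lambda>_. 0) z) * indicator S z)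
        + ennreal \<delta> * (ennreal (?f (\<lambda>j. (1 + l) * w j) z) * indicator S z)"
      by (auto simp: indicator_def)
  qed
  also have "\<dots> = ennreal (exp \<epsilon>) * emeasure (gaussian_vec J \<sigma> (\<lambda>_. 0)) S
      + ennreal \<delta> * emeasure (gaussian_vec J \<sigma> (\<lambda>j. (1 + l) * w j)) S"
    unfolding em by (simp add: nn_integral_add nn_integral_cmult)
  also have "\<dots> \<le> ennreal (exp \<epsilon>) * emeasure (gaussian_vec J \<sigma> (\<lambda>_. 0)) S + ennreal \<delta> * 1"
  proof -
    interpret prob_space "gaussian_vec J \<sigma> (\<lambda>j. (1 + l) * w j)"
      by (rule prob_space_gaussian_vec[OF assms(1)])
    show ?thesis by (intro add_left_mono mult_left_mono emeasure_le_1) auto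
  qed
  finally show ?thesis by simp
qed


text \<open>The noise is \<open>merge I J (x, y)\<close>. The shift \<open>w x\<close> to be hidden by \<open>y\<close> may depend on the rest \<open>x\<close>
  of the noise: conditionally on \<open>x\<close> it is constant.\<close>

lemma gaussian_vec_adaptive_privacy:
  fixes w :: "('i \<Rightarrow> real) \<Rightarrow> 'i \<Rightarrow> real"
  assumes "0 < \<sigma>" and fin: "finite I" "finite J" and disj: "I \<inter> J = {}"
    and "0 < k" and "0 < \<delta>" and "\<delta> < 1"
    and eps: "\<epsilon> = k\<^sup>2 + 2 * k * sqrt (ln (1 / \<delta>))"
    and w: "\<And>x. (\<Sum>j\<in>J. (w x j)\<^sup>2) \<le> 2 * k\<^sup>2 * \<sigma>\<^sup>2"
    and F: "F \<in> measurable (Pi\<^sub>M (I \<union> J) (\<lambda>_. borel)) N"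
    and F': "F' \<in> measurable (Pi\<^sub>M (I \<union> J) (\<lambda>_. borel)) N"
    and shift: "\<And>x y. F (merge I J (x, y)) = F' (merge I J (x, \<lambda>j\<in>J. y j + w x j))"
    and S: "S \<in> sets N"
  defines "G \<equiv> gaussian_vec (I \<union> J) \<sigma> (\<lambda>_. 0)"
  shows "emeasure (distr G N F) S \<le> ennreal (exp \<epsilon>) * emeasure (distr G N F') S + ennreal \<delta>"
proof -
  let ?N = "\<lambda>_::'i. density lborel (\<lambda>x. ennreal (normal_density 0 \<sigma> x))"
  let ?G = "\<lambda>J. gaussian_vec J \<sigma> (\<lambda>_. 0)"
  interpret N: product_sigma_finite ?N
    using prob_space_normal_density[OF \<open>0 < \<sigma>\<close>]
    by (intro product_sigma_finite.intro prob_space_imp_sigma_finite)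
  interpret I: prob_space "?G I" by (rule prob_space_gaussian_vec[OF assms(1)])
  have F_G: "F \<in> measurable G N" "F' \<in> measurable G N"
    using F F' unfolding G_def by (simp_all cong: measurable_cong_sets add: sets_gaussian_vec)
  define A where "A = F -` S \<inter> space G"
  define A' where "A' = F' -` S \<inter> space G"
  have A_sets: "A \<in> sets G" "A' \<in> sets G"
    unfolding A_def A'_def using F_G S by (auto intro: measurable_sets)
  have G_PiM: "?G K = Pi\<^sub>M K ?N" for K by (simp add: gaussian_vec_def)
  have spaceG: "space (?G K) = extensional K" for K :: "'i set"
    by (auto simp: gaussian_vec_def space_PiM PiE_def)
  \<comment> \<open>Fubini: the mass of an event is the integral over \<open>x\<close> of the masses
    of its sections, so it suffices to compare sections for each fixed \<open>x\<close>.\<close>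
  let ?sec = "\<lambda>A x. (\<lambda>y. merge I J (x, y)) -` A \<inter> space (?G J)"
  have fold: "emeasure G C = (\<integral>\<^sup>+x. emeasure (?G J) (?sec C x) \<partial>?G I)"
    and fold_meas: "(\<lambda>x. emeasure (?G J) (?sec C x)) \<in> borel_measurable (?G I)"
    if "C \<in> sets G" for C
    using N.emeasure_fold_integral[OF disj fin, of C] N.emeasure_fold_measurable[OF disj fin, of C] that
    unfolding G_def G_PiM by auto
  have sec: "emeasure (?G J) (?sec A x) \<le>
      ennreal (exp \<epsilon>) * emeasure (?G J) (?sec A' x) + ennreal \<delta>" if x: "x \<in> space (?G I)" for x
  proof -
    let ?B = "Pi\<^sub>M J (\<lambda>_. borel :: real measure)"
    let ?h = "\<lambda>y. \<lambda>j\<in>J. y j + w x j"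
    have h: "?h \<in> measurable (?G J) ?B" by measurable
    have "(\<lambda>y. merge I J (x, y)) \<in> measurable (?G J) (Pi\<^sub>M (I \<union> J) ?N)"
      using x unfolding G_PiM
      by (intro measurable_compose[OF measurable_Pair1' measurable_merge])
    then have "?sec A' x \<in> sets (?G J)"
      using A_sets(2) unfolding G_def G_PiM by (rule measurable_sets)
    then have sets: "?sec A' x \<in> sets ?B" by (simp add: sets_gaussian_vec)
    \<comment> \<open>By \<open>shift\<close>, adding \<open>w x\<close> to \<open>y\<close> carries
      the section for \<open>F\<close> to the one for \<open>F'\<close>; with \<open>x\<close> fixed
      this is a translation by a constant vector.\<close>
    have "?sec A x = ?h -` ?sec A' x \<inter> space (?G J)"
      by (auto simp: A_def A'_def G_def spaceG shift)
    then have "emeasure (?G J) (?sec A x) = emeasure (distr (?G J) ?B ?h) (?sec A' x)"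
      by (simp only: emeasure_distr[OF h sets])
    also have "\<dots> = emeasure (gaussian_vec J \<sigma> (w x)) (?sec A' x)"
      by (simp only: gaussian_vec_shift[OF fin(2) assms(1)])
    also have "\<dots> \<le> ennreal (exp \<epsilon>) * emeasure (?G J) (?sec A' x) + ennreal \<delta>"
      by (rule gaussian_vec_privacy[OF assms(1) fin(2) assms(5-7) eps w sets])
    finally show ?thesis .
  qed
  \<comment> \<open>Since \<open>?G I\<close> has total mass 1, integrating the constant
    \<open>\<delta>\<close> yields \<open>\<delta>\<close> again.\<close>
  have "emeasure G A \<le> (\<integral>\<^sup>+x. ennreal (exp \<epsilon>) * emeasure (?G J) (?sec A' x) + ennreal \<delta> \<partial>?G I)"
    unfolding fold[OF A_sets(1)] using sec by (rule nn_integral_mono)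
  also have "\<dots> = ennreal (exp \<epsilon>) * emeasure G A' + ennreal \<delta>"
    using fold_meas[OF A_sets(2)]
    by (simp add: fold[OF A_sets(2)] nn_integral_add nn_integral_cmult I.emeasure_space_1)
  finally show ?thesis
    using F_G S by (simp add: emeasure_distr A_def A'_def)
qed

section \<open>Boundedness of the truncation and of its smoothed version\<close>

lemma abs_trunc_phi_le: "\<bar>trunc_phi u\<bar> \<le> 2 * sqrt 2 / 3"
proof (cases "\<bar>u\<bar> \<le> sqrt 2")
  case True
  define r :: real where "r = sqrt 2"
  have r: "r * r = 2" "0 < r" by (simp_all add: r_def)
  have ur: "\<bar>u\<bar> \<le> r" using True by (simp add: r_def)
  have key: "x - x ^ 3 / 6 \<le> 2 * r / 3" if "\<bar>x\<bar> \<le> r" for x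
  proof -
    \<comment> \<open>This product is six times the gap \<open>2 * r / 3 - (x - x ^ 3 / 6)\<close>.
      The double root at \<open>r\<close> reflects that the derivative
      \<open>1 - x\<^sup>2 / 2\<close> vanishes there.\<close>
    have "0 \<le> (r - x)\<^sup>2 * (x + 2 * r)" using that r(2) by (intro mult_nonneg_nonneg) auto
    also have "\<dots> = x ^ 3 - 3 * (r * r) * x + 2 * r * (r * r)"
      by (simp add: power2_eq_square power3_eq_cube algebra_simps)
    finally show ?thesis by (simp add: r(1) power3_eq_cube)
  qed
  \<comment> \<open>The cubic is odd, so the lower bound is the upper bound at
    \<open>- u\<close>.\<close>
  have "u - u ^ 3 / 6 \<le> 2 * r / 3" "- (u - u ^ 3 / 6) \<le> 2 * r / 3"
    using key[of u] key[of "- u"] ur by simp_all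
  then have "\<bar>u - u ^ 3 / 6\<bar> \<le> 2 * r / 3" by linarith
  then show ?thesis using True by (simp add: trunc_phi_def r_def)
qed (auto simp: trunc_phi_def)

lemma trunc_phi_measurable [measurable]: "trunc_phi \<in> borel_measurable borel"
  unfolding trunc_phi_def by measurable

lemma prob_space_centered_gaussian: "0 < v \<Longrightarrow> prob_space (centered_gaussian v)"
  unfolding centered_gaussian_def by (rule prob_space_normal_density) simp

lemma sets_centered_gaussian [simp, measurable_cong]: "sets (centered_gaussian v) = sets borel"
  by (simp add: centered_gaussian_def)

lemma abs_integral_trunc_phi_le:
  assumes "0 < v"
  shows "\<bar>\<integral>\<xi>. trunc_phi ((1 + \<xi>) * a / s) \<partial>centered_gaussian v\<bar> \<le> 2 * sqrt 2 / 3"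
proof -
  interpret prob_space "centered_gaussian v" by (rule prob_space_centered_gaussian[OF assms])
  have int: "integrable (centered_gaussian v) (\<lambda>\<xi>. trunc_phi ((1 + \<xi>) * a / s))"
    using abs_trunc_phi_le by (intro integrable_const_bound[where B = "2 * sqrt 2 / 3"]) auto
  have bound: "trunc_phi u \<le> 2 * sqrt 2 / 3" "- (2 * sqrt 2 / 3) \<le> trunc_phi u" for u
    using abs_trunc_phi_le[of u] by linarith+
  show ?thesis
    using integral_le_const[OF int, of "2 * sqrt 2 / 3"] integral_ge_const[OF int, of "- (2 * sqrt 2 / 3)"]
      bound by (auto simp: abs_le_iff)
qed

section \<open>Measurability and sensitivity of the robust gradient\<close>

lemma borel_measurable_vec_nth [measurable (raw)]:
  fixes f :: "'a \<Rightarrow> real ^ 'd"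
  assumes "f \<in> borel_measurable M"
  shows "(\<lambda>x. f x $ j) \<in> borel_measurable M"
  using assms by (rule borel_measurable_continuous_on[OF continuous_on_component[OF continuous_on_id]])

lemma borel_measurable_vec_lambda:
  fixes f :: "'a \<Rightarrow> 'd::finite \<Rightarrow> real"
  assumes [measurable]: "\<And>j. (\<lambda>x. f x j) \<in> borel_measurable M"
  shows "(\<lambda>x. \<chi> j. f x j) \<in> borel_measurable M"
proof -
  have "(\<chi> j. f x j) = (\<Sum>j\<in>UNIV. f x j *\<^sub>R axis j 1)" for x
    by (simp add: vec_eq_iff axis_def if_distrib cong: if_cong)
  then show ?thesis by simp
qed

lemma robust_gradient_measurable:
  assumes [measurable]: "\<And>y. grad y \<in> borel_measurable borel" and "0 < lam"
  shows "robust_gradient grad m s lam I D \<in> borel_measurable borel"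
proof -
  \<comment> \<open>Makes the Gaussian sigma-finite, so that its integrals depend measurably on the
    parameter \<open>\<beta>\<close>.\<close>
  interpret prob_space "centered_gaussian (1 / lam)"
    using assms(2) by (intro prob_space_centered_gaussian) simp
  show ?thesis
    unfolding robust_gradient_def[abs_def]
    by (intro borel_measurable_vec_lambda) measurable
qed

text \<open>Only the summand of \<open>i0\<close> can change. Its two values lie within
  \<open>2 * sqrt 2 / 3\<close> of zero, so each coordinate moves by at most
  \<open>4 * sqrt 2 / 3\<close> times \<open>\<bar>s / m\<bar>\<close>, whatever the size of the
  gradients; the squares add up over the coordinates.\<close>

lemma robust_gradient_sensitivity:
  fixes grad :: "'r \<Rightarrow> real ^ 'd \<Rightarrow> real ^ 'd"
  assumes "0 < lam" and "finite I" and "i0 \<in> I"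
    and same: "\<And>i. i \<in> I \<Longrightarrow> i \<noteq> i0 \<Longrightarrow> D ! i = D' ! i"
  shows "(\<Sum>j\<in>UNIV. ((robust_gradient grad m s lam I D \<beta> - robust_gradient grad m s lam I D' \<beta>) $ j)\<^sup>2)
    \<le> 32 * s\<^sup>2 * real CARD('d) / (9 * m\<^sup>2)"
proof -
  let ?e = "\<lambda>D i j. \<integral>\<xi>. trunc_phi ((1 + \<xi>) * (grad (D ! i) \<beta> $ j) / s) \<partial>centered_gaussian (1 / lam)"
  let ?r = "\<lambda>D. robust_gradient grad m s lam I D \<beta>"
  have "((?r D - ?r D') $ j)\<^sup>2 \<le> 32 * s\<^sup>2 / (9 * m\<^sup>2)" for j
  proof -
    have "(\<Sum>i\<in>I - {i0}. ?e D i j) = (\<Sum>i\<in>I - {i0}. ?e D' i j)"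
      using same by (intro sum.cong) auto
    then have "(\<Sum>i\<in>I. ?e D i j) - (\<Sum>i\<in>I. ?e D' i j) = ?e D i0 j - ?e D' i0 j"
      using assms(2,3) by (simp add: sum.remove[of I i0])
    then have diff: "(?r D - ?r D') $ j = s / m * (?e D i0 j - ?e D' i0 j)"
      by (simp only: robust_gradient_def vec_lambda_beta vector_minus_component
          right_diff_distrib[symmetric])
    have "\<bar>?e D i0 j\<bar> \<le> 2 * sqrt 2 / 3" for D
      using assms(1) by (intro abs_integral_trunc_phi_le) simp
    from this[of D] this[of D'] have "\<bar>?e D i0 j - ?e D' i0 j\<bar> \<le> 4 * sqrt 2 / 3"
      by linarith
    then have "\<bar>?e D i0 j - ?e D' i0 j\<bar>\<^sup>2 \<le> (4 * sqrt 2 / 3)\<^sup>2"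
      by (intro power_mono) auto
    then have "(?e D i0 j - ?e D' i0 j)\<^sup>2 \<le> 32 / 9"
      by (simp add: power_divide power_mult_distrib)
    then have "(s / m)\<^sup>2 * (?e D i0 j - ?e D' i0 j)\<^sup>2 \<le> (s / m)\<^sup>2 * (32 / 9)"
      by (intro mult_left_mono) auto
    then show ?thesis
      unfolding diff by (simp add: power_mult_distrib power_divide mult.commute)
  qed
  then have "(\<Sum>j\<in>UNIV. ((?r D - ?r D') $ j)\<^sup>2) \<le> (\<Sum>j\<in>(UNIV :: 'd set). 32 * s\<^sup>2 / (9 * m\<^sup>2))"
    by (rule sum_mono)
  then show ?thesis by (simp add: mult_ac)
qed

section \<open>Privacy of the iteration for a fixed partition\<close>

text \<open>The noisy gradients are compared along the second trajectory only: by induction the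
  first run sits at the same point when the next step is taken.\<close>

lemma em_iterate_cong:
  assumes "\<And>u. u < t \<Longrightarrow>
    robust_gradient grad m s lam (B u) D (em_iterate grad \<beta>0 \<eta> m s lam B D' z' u) + (\<chi> j. z (u, j)) =
    robust_gradient grad m s lam (B u) D' (em_iterate grad \<beta>0 \<eta> m s lam B D' z' u) + (\<chi> j. z' (u, j))"
  shows "em_iterate grad \<beta>0 \<eta> m s lam B D z t = em_iterate grad \<beta>0 \<eta> m s lam B D' z' t"
  using assms by (induction t) (simp_all add: Let_def)

lemma em_iterate_measurable:
  fixes grad :: "'r \<Rightarrow> real ^ 'd \<Rightarrow> real ^ 'd"
  assumes grad: "\<And>y. grad y \<in> borel_measurable borel" and "0 < lam" and "t \<le> T"
  shows "(\<lambda>z. em_iterate grad \<beta>0 \<eta> m s lam B D z t) \<in>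
    borel_measurable (Pi\<^sub>M ({..<T} \<times> UNIV) (\<lambda>_. borel))"
  using \<open>t \<le> T\<close>
proof (induction t)
  case (Suc t)
  note [measurable] = robust_gradient_measurable[OF grad assms(2)]
  have [measurable]: "(\<lambda>z. em_iterate grad \<beta>0 \<eta> m s lam B D z t) \<in>
      borel_measurable (Pi\<^sub>M ({..<T} \<times> UNIV) (\<lambda>_. borel))"
    using Suc by simp
  have [measurable]: "(\<lambda>z. (\<chi> j. z (t, j)) :: real ^ 'd)
      \<in> borel_measurable (Pi\<^sub>M ({..<T} \<times> UNIV) (\<lambda>_. borel))"
    using Suc.prems by (intro borel_measurable_vec_lambda measurable_component_singleton) auto
  show ?case by (simp add: Let_def)
qed simp

text \<open>An instance of \<open>gaussian_vec_adaptive_privacy\<close>: block \<open>?J\<close> is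
  the noise of the step whose batch contains the differing record, and block \<open>?I\<close> is
  the noise of all other steps.\<close>

lemma em_iterate_privacy:
  fixes grad :: "'r \<Rightarrow> real ^ 'd \<Rightarrow> real ^ 'd"
  assumes grad: "\<And>y. grad y \<in> borel_measurable borel"
    and "0 < lam" and "0 < s" and "0 < m" and "0 < k" and "0 < \<delta>" and "\<delta> < 1"
    and eps: "\<epsilon> = k\<^sup>2 + 2 * k * sqrt (ln (1 / \<delta>))"
    and B: "equipartition n T B"
    and D: "length D = n" "neighbors D D'"
    and S: "S \<in> sets borel"
  defines "G \<equiv> Pi\<^sub>M ({..<T} \<times> UNIV) (\<lambda>_. centered_gaussian (noise_variance CARD('d) m s k))"
  shows "emeasure (distr G borel (\<lambda>z. em_iterate grad \<beta>0 \<eta> m s lam B D z T)) S \<le>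
    ennreal (exp \<epsilon>) * emeasure (distr G borel (\<lambda>z. em_iterate grad \<beta>0 \<eta> m s lam B D' z T)) S
    + ennreal \<delta>"
proof -
  have "card {i. i < n \<and> D ! i \<noteq> D' ! i} = 1"
    using D(2) unfolding neighbors_def D(1) by blast
  then obtain i0 where i0: "{i. i < n \<and> D ! i \<noteq> D' ! i} = {i0}"
    by (rule card_1_singletonE)
  then have "i0 < n" by blast
  then have "i0 \<in> (\<Union>t<T. B t)"
    using B by (simp add: equipartition_def)
  then obtain t0 where t0: "t0 < T" "i0 \<in> B t0" by blast
  have sub: "B u \<subseteq> {..<n}" if "u < T" for u
    using B that unfolding equipartition_def by blast
  have same: "D ! i = D' ! i" if "i \<in> B u" "u < T" "i \<noteq> i0" for i u
    using sub[OF that(2)] that i0 by blast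
  have other: "i0 \<notin> B u" if "u < T" "u \<noteq> t0" for u
    using B t0 that by (auto simp: equipartition_def disjoint_family_on_def)
  let ?it = "\<lambda>D z. em_iterate grad \<beta>0 \<eta> m s lam B D z"
  let ?r = "\<lambda>u D. robust_gradient grad m s lam (B u) D"
  let ?I = "({..<T} - {t0}) \<times> (UNIV :: 'd set)"
  let ?J = "{t0} \<times> (UNIV :: 'd set)"
  have IJ: "?I \<union> ?J = {..<T} \<times> UNIV" "?I \<inter> ?J = {}" using t0 by auto
  define \<sigma> where "\<sigma> = sqrt (noise_variance CARD('d) m s k)"
  have var: "0 < noise_variance CARD('d) m s k"
    using assms(3-5) by (simp add: noise_variance_def zero_less_divide_iff)
  then have "0 < \<sigma>" and \<sigma>2: "\<sigma>\<^sup>2 = noise_variance CARD('d) m s k" by (simp_all add: \<sigma>_def)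
  have G: "G = gaussian_vec (?I \<union> ?J) \<sigma> (\<lambda>_. 0)"
    by (simp add: G_def gaussian_vec_def centered_gaussian_def IJ \<sigma>_def)
  \<comment> \<open>The iterate entering step \<open>t0\<close> uses only noise of steps before
    \<open>t0\<close>, so the value \<open>0\<close> put on block \<open>?J\<close> is arbitrary and
    \<open>\<beta>\<close> is a function of \<open>x\<close> alone.\<close>
  define \<beta> where "\<beta> x = ?it D' (merge ?I ?J (x, \<lambda>_. 0)) t0" for x
  \<comment> \<open>Adding this difference to the noise of the run on \<open>D'\<close> compensates
    for the change of the gradient at step \<open>t0\<close>.\<close>
  define w where "w x p = (?r t0 D (\<beta> x) - ?r t0 D' (\<beta> x)) $ snd p"
    for x and p :: "nat \<times> 'd"
  show ?thesis
    unfolding G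
  proof (rule gaussian_vec_adaptive_privacy[where w = w and k = k])
    show "(\<Sum>p\<in>?J. (w x p)\<^sup>2) \<le> 2 * k\<^sup>2 * \<sigma>\<^sup>2" for x
    proof -
      have "(\<Sum>p\<in>?J. (w x p)\<^sup>2) = (\<Sum>j\<in>UNIV. ((?r t0 D (\<beta> x) - ?r t0 D' (\<beta> x)) $ j)\<^sup>2)"
        by (intro sum.reindex_bij_witness[where i = "Pair t0" and j = snd]) (auto simp: w_def)
      also have "\<dots> \<le> 32 * s\<^sup>2 * real CARD('d) / (9 * m\<^sup>2)"
        using t0 same finite_subset[OF sub[OF t0(1)]]
        by (intro robust_gradient_sensitivity[OF assms(2), where ?i0.0 = i0]) auto
      \<comment> \<open>The noise variance is calibrated so that the sensitivity bound meets the
        admissible shift length exactly.\<close>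
      also have "\<dots> = 2 * k\<^sup>2 * \<sigma>\<^sup>2"
        using \<open>0 < k\<close> by (simp add: \<sigma>2 noise_variance_def)
      finally show ?thesis .
    qed
    show "?it D (merge ?I ?J (x, y)) T = ?it D' (merge ?I ?J (x, \<lambda>p\<in>?J. y p + w x p)) T" for x y
    proof (rule em_iterate_cong)
      let ?z = "merge ?I ?J (x, y)" and ?z' = "merge ?I ?J (x, \<lambda>p\<in>?J. y p + w x p)"
      fix u assume "u < T"
      show "?r u D (?it D' ?z' u) + (\<chi> j. ?z (u, j)) = ?r u D' (?it D' ?z' u) + (\<chi> j. ?z' (u, j))"
      proof (cases "u = t0")
        case True
        \<comment> \<open>Here \<open>em_iterate_cong\<close> compares two runs on the same dataset
          whose noise differs only from block \<open>?J\<close>, hence not before step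
          \<open>t0\<close>.\<close>
        have it: "?it D' ?z' t0 = \<beta> x"
          unfolding \<beta>_def using t0 by (intro em_iterate_cong) (simp add: merge_def)
        show ?thesis
          unfolding True it by (simp add: vec_eq_iff merge_def w_def)
      next
        case False
        have "?r u D b = ?r u D' b" for b
        proof -
          have "D ! i = D' ! i" if "i \<in> B u" for i
            using same[OF that \<open>u < T\<close>] other[OF \<open>u < T\<close> False] that by metis
          then show ?thesis by (simp add: robust_gradient_def cong: sum.cong)
        qed
        then show ?thesis using False \<open>u < T\<close> by (simp add: merge_def)
      qed
    qed
    show "(\<lambda>z. ?it D z T) \<in> borel_measurable (Pi\<^sub>M (?I \<union> ?J) (\<lambda>_. borel))"
      and "(\<lambda>z. ?it D' z T) \<in> borel_measurable (Pi\<^sub>M (?I \<union> ?J) (\<lambda>_. borel))"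
      unfolding IJ by (intro em_iterate_measurable grad assms(2) order_refl)+
  qed (use assms IJ \<open>0 < \<sigma>\<close> in auto)
qed

section \<open>Choice of parameters and averaging over the random partition\<close>

theorem theorem4:
  fixes grad :: "'r \<Rightarrow> real ^ 'd \<Rightarrow> real ^ 'd"
    and \<beta>0 :: "real ^ 'd"
    and \<tau> \<eta> \<zeta> \<epsilon> \<delta> :: real
    and n T :: nat
    and P :: "(nat \<Rightarrow> nat set) pmf"
  assumes grad_measurable: "\<And>y. grad y \<in> borel_measurable borel"
    and "0 < n" and "T dvd n"
    and partition: "\<And>B. B \<in> set_pmf P \<Longrightarrow> equipartition n T B"
    and "0 < \<tau>" and "0 < \<eta>"
    and "0 < \<zeta>" and "\<zeta> < 1"
    and "0 < \<epsilon>" and "\<epsilon> < 1"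
    and "0 < \<delta>" and "\<delta> < 1"
  shows "differentially_private \<epsilon> \<delta> n borel (dp_gradient_em grad \<beta>0 \<tau> T \<eta> \<zeta> \<epsilon> \<delta> P)"
proof -
  define m where "m = real n / real T"
  define k where "k = eps_tilde \<epsilon> \<delta>"
  define s where "s = trunc_scale CARD('d) m \<tau> \<zeta> k"
  define lam where "lam = smoothing_precision CARD('d) \<zeta>"
  define G :: "(nat \<times> 'd \<Rightarrow> real) measure" where
    "G = Pi\<^sub>M ({..<T} \<times> UNIV) (\<lambda>_. centered_gaussian (noise_variance CARD('d) m s k))"
  define K where "K D B = distr G borel (\<lambda>z. em_iterate grad \<beta>0 \<eta> m s lam B D z T)" for D B
  \<comment> \<open>Divisibility of the positive \<open>n\<close> by \<open>T\<close> excludes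
    \<open>T = 0\<close>.\<close>
  have "0 < m" using assms(2,3) by (auto simp: m_def intro!: divide_pos_pos Nat.gr0I)
  have "0 < k" using \<open>0 < \<epsilon>\<close> by (simp add: k_def eps_tilde_def)
  have "0 \<le> ln (1 / \<delta>)" using \<open>0 < \<delta>\<close> \<open>\<delta> < 1\<close> by simp
  \<comment> \<open>Completing the square: \<open>k + sqrt (ln (1 / \<delta>))\<close> is by
    definition the square root of \<open>ln (1 / \<delta>) + \<epsilon>\<close>.\<close>
  have eps: "\<epsilon> = k\<^sup>2 + 2 * k * sqrt (ln (1 / \<delta>))"
  proof -
    have "(k + sqrt (ln (1 / \<delta>)))\<^sup>2 = ln (1 / \<delta>) + \<epsilon>"
      using \<open>0 \<le> ln (1 / \<delta>)\<close> \<open>0 < \<epsilon>\<close> by (simp add: k_def eps_tilde_def)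
    moreover have "(sqrt (ln (1 / \<delta>)))\<^sup>2 = ln (1 / \<delta>)"
      using \<open>0 \<le> ln (1 / \<delta>)\<close> by (rule real_sqrt_pow2)
    ultimately show ?thesis by (simp add: power2_sum)
  qed
  \<comment> \<open>The dimension is at least 1 and exceeds \<open>\<zeta>\<close>, which makes the
    logarithm in \<open>s\<close> and \<open>lam\<close> positive.\<close>
  have "1 \<le> real CARD('d)" by (simp add: Suc_leI)
  then have "\<zeta> < real CARD('d)" using \<open>\<zeta> < 1\<close> by linarith
  then have "0 < ln (real CARD('d) / \<zeta>)" using \<open>0 < \<zeta>\<close> by (intro ln_gt_zero) simp
  then have "0 < lam" and "0 < s"
    using \<open>0 < m\<close> \<open>0 < k\<close> \<open>0 < \<tau>\<close> by (simp_all add: lam_def smoothing_precision_def s_def trunc_scale_def)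
  have "0 < noise_variance CARD('d) m s k"
    using \<open>0 < m\<close> \<open>0 < k\<close> \<open>0 < s\<close> by (simp add: noise_variance_def zero_less_divide_iff)
  then interpret G: prob_space G
    unfolding G_def by (intro prob_space_PiM prob_space_centered_gaussian)
  have "sets G = sets (Pi\<^sub>M ({..<T} \<times> UNIV) (\<lambda>_. borel))"
    unfolding G_def by (intro sets_PiM_cong) auto
  then have "(\<lambda>z. em_iterate grad \<beta>0 \<eta> m s lam B D z T) \<in> borel_measurable G" for B D
    using em_iterate_measurable[where grad = grad, OF grad_measurable \<open>0 < lam\<close> order_refl]
    by (simp cong: measurable_cong_sets)
  then have K_prob: "prob_space (K D B)" for D B
    unfolding K_def by (rule G.prob_space_distr)
  \<comment> \<open>Every set is measurable for \<open>measure_pmf P\<close>, so the kernel only has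
    to take values in probability measures on \<open>borel\<close>.\<close>
  then have K: "K D \<in> measurable (measure_pmf P) (subprob_algebra borel)" for D
    by (auto simp: space_subprob_algebra K_def intro!: prob_space_imp_subprob_space)
  have dp: "dp_gradient_em grad \<beta>0 \<tau> T \<eta> \<zeta> \<epsilon> \<delta> P D = measure_pmf P \<bind> K D"
    if "length D = n" for D
    by (simp add: dp_gradient_em_def Let_def that K_def[abs_def] G_def lam_def s_def k_def m_def)
  have prob: "prob_space (measure_pmf P \<bind> K D)" for D
    using K_prob K by (intro measure_pmf.prob_space_bind[where S = borel]) auto
  have em: "emeasure (measure_pmf P \<bind> K D) S = (\<integral>\<^sup>+B. emeasure (K D B) S \<partial>measure_pmf P)"
    if "S \<in> sets borel" for D S
    using K that by (intro emeasure_bind) auto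
  have "measure (measure_pmf P \<bind> K D) S \<le> exp \<epsilon> * measure (measure_pmf P \<bind> K D') S + \<delta>"
    if "length D = n" "neighbors D D'" and S: "S \<in> sets borel" for D D' S
  proof -
    interpret D: prob_space "measure_pmf P \<bind> K D" by (rule prob)
    interpret D': prob_space "measure_pmf P \<bind> K D'" by (rule prob)
    have "emeasure (K D B) S \<le> ennreal (exp \<epsilon>) * emeasure (K D' B) S + ennreal \<delta>"
      if "B \<in> set_pmf P" for B
      unfolding K_def G_def
      by (rule em_iterate_privacy[OF grad_measurable \<open>0 < lam\<close> \<open>0 < s\<close> \<open>0 < m\<close> \<open>0 < k\<close> \<open>0 < \<delta>\<close>
            \<open>\<delta> < 1\<close> eps partition[OF that] \<open>length D = n\<close> \<open>neighbors D D'\<close> S])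
    \<comment> \<open>The bound for a fixed partition is affine in the probability on the right and
      \<open>P\<close> is the same for both datasets, so averaging over \<open>B\<close> preserves
      it.\<close>
    then have "emeasure (measure_pmf P \<bind> K D) S
        \<le> (\<integral>\<^sup>+B. ennreal (exp \<epsilon>) * emeasure (K D' B) S + ennreal \<delta> \<partial>measure_pmf P)"
      unfolding em[OF S] by (intro nn_integral_mono_AE) (simp add: AE_measure_pmf_iff)
    also have "\<dots> = ennreal (exp \<epsilon>) * emeasure (measure_pmf P \<bind> K D') S + ennreal \<delta>"
      by (simp add: em[OF S] nn_integral_add nn_integral_cmult)
    also have "\<dots> = ennreal (exp \<epsilon> * measure (measure_pmf P \<bind> K D') S + \<delta>)"
      using \<open>0 < \<delta>\<close> by (simp add: D'.emeasure_eq_measure ennreal_mult ennreal_plus)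
    finally show ?thesis
      using \<open>0 < \<delta>\<close> unfolding D.emeasure_eq_measure by (subst (asm) ennreal_le_iff) auto
  qed
  then show ?thesis
    using prob K by (auto simp: differentially_private_def dp sets_bind_measurable)
qed

end
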